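(* Let $q=4$ or $q\ge 7$ be a prime power, and let $\rho\ge 0$ be an integer. Let $S_\rho\subset\mathrm{PG}(2\rho+1,q)$ be the $((\rho+1)q+1)$-set defined below. Then: (i) $S_\rho$ is a minimal $\rho$-saturating set in $\mathrm{PG}(2\rho+1,q)$. (ii) Let $N_\rho$ be the set of points of $\mathrm{PG}(2\rho+1,q)$ that are not $\rho$-covered by $S_\rho\setminus\{e_{2\rho+1}\}$. Then $N_0=M_0$, $N_1=M_1$, and for $\rho\ge 2$, $N_\rho$ is a proper subset of $M_\rho$, where the sets $M_\rho$ are defined below. (iii) The $(\rho+1)q$-set $S_\rho\setminus\{e_{2\rho+1}\}$ is $(\rho+1)$-saturating in $\mathrm{PG}(2\rho+1,q)$.
   Context: Points of $\mathrm{PG}(2\rho+1,q)$ are written in homogeneous coordinates $(x_0,x_1,\dots,x_{2\rho+1})$, $x_i\in\mathbb{F}_q$; $e_0,\dots,e_{2\rho+1}$ denote the standard unit vectors (as points). The set $S_\rho$ is \[ S_\rho=\{e_0\}\cup\{e_0+ae_1: a\in\mathbb{F}_q^*\}\cup\bigcup_{u=1}^{\rho}\Big(\{e_{2u-1}+ae_{2u}+a^2e_{2u+1}: a\in\mathbb{F}_q^*\}\cup\{e_{2u}\}\Big)\cup\{e_{2\rho+1}\}, \] which has $(\rho+1)q+1$ points (for $\rho=0$ it is all of $\mathrm{PG}(1,q)$). A point set $S\subseteq\mathrm{PG}(N,q)$ is $\rho$-saturating if every point of $\mathrm{PG}(N,q)$ is a linear combination of at most $\rho+1$ points of $S$, and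 $\rho$ is the smallest value with this property; it is minimal if it contains no smaller $\rho$-saturating set. A point $A$ is $\rho$-covered by a set $S$ if $A$ is a linear combination of at most $\rho+1$ points of $S$. Define sets of vectors: $M_0=\{(x_0,x_1)\in\mathbb{F}_q^2: x_0=0,\ x_1\neq 0\}$, and for $\rho\ge1$, $M_\rho=\{(x_0,\dots,x_{2\rho+1})\in\mathbb{F}_q^{2\rho+2}: (x_0,\dots,x_{2\rho-1})\notin M_{\rho-1},\ x_{2\rho}=0,\ x_{2\rho+1}\ne 0\}$; a point is said to belong to $M_\rho$ if its coordinate vectors do. *)

theory Defs
  imports Complex_Main "HOL-Library.Function_Algebras" "HOL-Library.Cardinality"
begin

text \<open>Vectors over the field \<open>'a\<close> are functions \<^typ>\<open>nat \<Rightarrow> 'a\<close>, and the space of \<open>n\<close>-tuples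
  consists of those vanishing from index \<open>n\<close> on. So a vector with fewer coordinates is identified
  with its extension by zeros.\<close>

definition vscale :: "'a::field \<Rightarrow> (nat \<Rightarrow> 'a) \<Rightarrow> nat \<Rightarrow> 'a" (infixr "\<cdot>\<^sub>v" 75) where
  "c \<cdot>\<^sub>v x = (\<lambda>i. c * x i)"

interpretation fv: vector_space "vscale :: 'a::field \<Rightarrow> (nat \<Rightarrow> 'a) \<Rightarrow> nat \<Rightarrow> 'a"
  by standard (auto simp: vscale_def fun_eq_iff algebra_simps)

definition vecs :: "nat \<Rightarrow> (nat \<Rightarrow> 'a::field) set" where
  "vecs n = {x. \<forall>i\<ge>n. x i = 0}"

definition unit_vec :: "nat \<Rightarrow> nat \<Rightarrow> 'a::field" where
  "unit_vec k = (\<lambda>i. if i = k then 1 else 0)"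

definition truncate :: "nat \<Rightarrow> (nat \<Rightarrow> 'a::field) \<Rightarrow> nat \<Rightarrow> 'a" where
  "truncate n x = (\<lambda>i. if i < n then x i else 0)"

text \<open>The point with homogeneous coordinates \<open>x\<close> is the one-dimensional subspace spanned by \<open>x\<close>.\<close>

definition point :: "(nat \<Rightarrow> 'a::field) \<Rightarrow> (nat \<Rightarrow> 'a) set" where
  "point x = fv.span {x}"

definition PG :: "nat \<Rightarrow> (nat \<Rightarrow> 'a::field) set set" where
  "PG N = point ` (vecs (N + 1) - {0})"

definition lin_comb_of_at_most :: "nat \<Rightarrow> (nat \<Rightarrow> 'a::field) set set \<Rightarrow> (nat \<Rightarrow> 'a) set \<Rightarrow> bool" where
  "lin_comb_of_at_most k S A \<longleftrightarrow>
     (\<exists>T\<subseteq>S. finite T \<and> card T \<le> k \<and> A \<subseteq> fv.span (\<Union>T))"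

definition covered :: "nat \<Rightarrow> (nat \<Rightarrow> 'a::field) set set \<Rightarrow> (nat \<Rightarrow> 'a) set \<Rightarrow> bool" where
  "covered \<rho> S A \<longleftrightarrow> lin_comb_of_at_most (\<rho> + 1) S A"

definition saturating :: "nat \<Rightarrow> nat \<Rightarrow> (nat \<Rightarrow> 'a::field) set set \<Rightarrow> bool" where
  "saturating N \<rho> S \<longleftrightarrow> S \<subseteq> PG N \<and> (\<forall>A\<in>PG N. covered \<rho> S A) \<and>
     (\<forall>\<rho>'<\<rho>. \<not> (\<forall>A\<in>PG N. covered \<rho>' S A))"

definition minimal_saturating :: "nat \<Rightarrow> nat \<Rightarrow> (nat \<Rightarrow> 'a::field) set set \<Rightarrow> bool" where
  "minimal_saturating N \<rho> S \<longleftrightarrow> saturating N \<rho> S \<and> \<not> (\<exists>T\<subset>S. saturating N \<rho> T)"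

definition S_set :: "nat \<Rightarrow> (nat \<Rightarrow> 'a::field) set set" where
  "S_set \<rho> = point `
     ({unit_vec 0} \<union> {unit_vec 0 + a \<cdot>\<^sub>v unit_vec 1 | a. a \<noteq> 0} \<union>
      (\<Union>u\<in>{1..\<rho>}. {unit_vec (2*u - 1) + a \<cdot>\<^sub>v unit_vec (2*u) + a\<^sup>2 \<cdot>\<^sub>v unit_vec (2*u + 1) | a. a \<noteq> 0} \<union> {unit_vec (2*u)}) \<union>
      {unit_vec (2*\<rho> + 1)})"

definition S_minus :: "nat \<Rightarrow> (nat \<Rightarrow> 'a::field) set set" where
  "S_minus \<rho> = S_set \<rho> - {point (unit_vec (2*\<rho> + 1))}"

definition N_set :: "nat \<Rightarrow> (nat \<Rightarrow> 'a::field) set set" where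
  "N_set \<rho> = {A \<in> PG (2*\<rho> + 1). \<not> covered \<rho> (S_minus \<rho>) A}"

text \<open>The zero tuple is never in \<open>M_vecs \<rho>\<close>, so in the recursion a vector whose first \<open>2\<rho>\<close>
  coordinates all vanish is not excluded.\<close>

primrec M_vecs :: "nat \<Rightarrow> (nat \<Rightarrow> 'a::field) set" where
  "M_vecs 0 = {x \<in> vecs 2. x 0 = 0 \<and> x 1 \<noteq> 0}"
| "M_vecs (Suc r) = {x \<in> vecs (2 * Suc r + 2).
     truncate (2 * Suc r) x \<notin> M_vecs r \<and> x (2 * Suc r) = 0 \<and> x (2 * Suc r + 1) \<noteq> 0}"

definition M_set :: "nat \<Rightarrow> (nat \<Rightarrow> 'a::field) set set" where
  "M_set \<rho> = {A \<in> PG (2*\<rho> + 1). A - {0} \<subseteq> M_vecs \<rho>}"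

end

(* S_rho splits into blocks: for u >= 1 the vectors blk u a lie in the plane
   <e_{2u-1}, e_{2u}, e_{2u+1}> (a conic minus two points, together with the intersection
   e_{2u} of the tangents there), and block 0 is a punctured line; e_{2 rho+1} is left over.

   Upper bounds. Let M' n be M_{n-1}, with M' 0 empty. By two-step induction on n, a vector with
   2n coordinates is a combination of n vectors from the first n blocks if it is not in M' n, and
   of n+1 such vectors in any case. If the vector with its last two coordinates removed stays
   outside M' (n-1) after any change of its last coordinate, one vector of the last block takes
   care of the two removed coordinates. Otherwise the vector is y + (m, s, t) with y covered by
   n-2 vectors, and (m, s, t) is a combination of two vectors of the last block as soon as two of
   m, s, t are nonzero; this is where q = 4 or q >= 7 is needed.

   Lower bounds. Coordinate 2u is nonzero on block u only, so a vector all of whose even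
   coordinates are nonzero needs a vector from every block. If it uses exactly one from each,
   these are determined from the top down by the ratios x_{2u+1} / x_{2u}. *)

theory Submission
  imports Defs "HOL-Computational_Algebra.Polynomial"
begin

section \<open>The blocks, and combinations of at most k vectors\<close>

text \<open>For \<open>u > 0\<close> the conic parameter 0 would give e_{2u-1}, which is not in the
  set; that slot holds e_{2u} instead, so that every block is indexed by the whole field.\<close>

definition blk :: "nat \<Rightarrow> 'a::field \<Rightarrow> nat \<Rightarrow> 'a" where
  "blk u a = (if u = 0 then unit_vec 0 + a \<cdot>\<^sub>v unit_vec 1
     else if a = 0 then unit_vec (2*u)
     else unit_vec (2*u - 1) + a \<cdot>\<^sub>v unit_vec (2*u) + a\<^sup>2 \<cdot>\<^sub>v unit_vec (2*u + 1))"

definition blks :: "nat \<Rightarrow> (nat \<Rightarrow> 'a::field) set" where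
  "blks n = {blk u a | u a. u < n}"

text \<open>The shift by one makes the recursion for \<open>M_vecs\<close> uniform, starting from the empty set.\<close>

definition Mv :: "nat \<Rightarrow> (nat \<Rightarrow> 'a::field) set" where
  "Mv n = (case n of 0 \<Rightarrow> {} | Suc r \<Rightarrow> M_vecs r)"

text \<open>The vector counterpart of \<open>lin_comb_of_at_most\<close>;
  \<open>lin_comb_point\<close> identifies the two.\<close>

definition comb :: "(nat \<Rightarrow> 'a::field) set \<Rightarrow> nat \<Rightarrow> (nat \<Rightarrow> 'a) \<Rightarrow> bool" where
  "comb V k x \<longleftrightarrow> (\<exists>W\<subseteq>V. finite W \<and> card W \<le> k \<and> x \<in> fv.span W)"

lemma blk_0: "blk 0 a i = (if i = 0 then 1 else if i = 1 then a else 0)"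
  by (auto simp: blk_def unit_vec_def vscale_def)

lemma blk_Suc:
  "blk (Suc n) a i = (if i = 2*n+1 then (if a = 0 then 0 else 1)
     else if i = 2*n+2 then (if a = 0 then 1 else a)
     else if i = 2*n+3 then a\<^sup>2 else 0)"
  by (auto simp: blk_def unit_vec_def vscale_def)

lemma blk_even_nonzero: "blk u a (2*u) \<noteq> 0"
  by (cases u) (auto simp: blk_0 blk_Suc)

lemma blk_even_other: "w \<noteq> u \<Longrightarrow> blk u a (2*w) = 0"
proof (cases u)
  case (Suc n)
  moreover assume "w \<noteq> u"
  moreover have "2*w \<noteq> 2*n+1" "2*w \<noteq> 2*n+3" by presburger+
  ultimately show ?thesis by (simp add: blk_Suc)
qed (simp add: blk_0)

text \<open>This ratio recovers the parameter, including the slot 0 of e_{2u}; the lower bounds read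
  off parameters in this way.\<close>

lemma blk_odd: "blk u a (2*u+1) = a * blk u a (2*u)"
  by (cases u) (auto simp: blk_0 blk_Suc power2_eq_square)

text \<open>Neighbouring blocks overlap: coordinate \<open>2*w+1\<close> is the last one of block
  \<open>w\<close> and the first one of block \<open>Suc w\<close>.\<close>

lemma blk_odd_other: "w \<noteq> u \<Longrightarrow> u \<noteq> Suc w \<Longrightarrow> blk u a (2*w+1) = 0"
proof (cases u)
  case (Suc n)
  moreover assume "w \<noteq> u" "u \<noteq> Suc w"
  moreover have "2*w+1 \<noteq> 2*n+2" by presburger
  ultimately show ?thesis by (simp add: blk_Suc)
qed (simp add: blk_0)

lemma blk_Suc_0_odd: "blk (Suc w) 0 (2*w+1) = 0"
  by (simp add: blk_Suc)

lemma blk_in_vecs: "u < n \<Longrightarrow> blk u a \<in> vecs (2*n)"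
  by (cases u) (auto simp: blk_0 blk_Suc vecs_def)

text \<open>Scaling changes neither the position of the only nonzero even coordinate, which gives
  the block, nor the ratio in \<open>blk_odd\<close>, which gives the parameter.\<close>

lemma blk_scale_inj:
  assumes "blk u a = k \<cdot>\<^sub>v blk u' a'"
  shows "u = u' \<and> a = a'"
proof -
  have e: "blk u a i = k * blk u' a' i" for i
    using assms by (simp add: vscale_def)
  have u: "u = u'"
    using e[of "2*u"] blk_even_nonzero[of u a] blk_even_other[of u u' a'] by fastforce
  have "a * blk u a (2*u) = a' * blk u a (2*u)"
    using e[of "2*u"] e[of "2*u+1"] u by (simp add: blk_odd del: One_nat_def)
  with u show ?thesis using blk_even_nonzero[of u a] by simp
qed

lemma blk_inj: "blk u a = blk u' a' \<Longrightarrow> u = u' \<and> a = a'"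
  by (rule blk_scale_inj[where k = 1]) (simp add: vscale_def)

lemma blk_noteq_unit_odd: "blk u a \<noteq> k \<cdot>\<^sub>v unit_vec (2*r+1)"
proof
  assume "blk u a = k \<cdot>\<^sub>v unit_vec (2*r+1)"
  from fun_cong[OF this, of "2*u"] show False
    using blk_even_nonzero[of u a] by (simp add: vscale_def unit_vec_def, presburger)
qed

lemma mem_Mv_Suc:
  "x \<in> Mv (Suc n) \<longleftrightarrow> x \<in> vecs (2*n+2) \<and> truncate (2*n) x \<notin> Mv n \<and> x (2*n) = 0 \<and> x (2*n+1) \<noteq> 0"
  by (cases n) (auto simp: Mv_def numeral_2_eq_2)

lemma truncate_in_vecs: "truncate n x \<in> vecs n"
  by (simp add: truncate_def vecs_def)

lemma comb_0: "comb V k 0"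
  by (auto simp: comb_def intro!: exI[of _ "{}"])

lemma comb_mono: "comb V k x \<Longrightarrow> V \<subseteq> V' \<Longrightarrow> k \<le> k' \<Longrightarrow> comb V' k' x"
  unfolding comb_def by (meson order_trans)

lemma comb_add:
  assumes "comb V k (x - c \<cdot>\<^sub>v v)" "V \<subseteq> V'" "v \<in> V'"
  shows "comb V' (Suc k) x"
proof -
  obtain W where W: "W \<subseteq> V" "finite W" "card W \<le> k" "x - c \<cdot>\<^sub>v v \<in> fv.span W"
    using assms(1) by (auto simp: comb_def)
  have "x \<in> fv.span (insert v W)"
    using W(4) by (auto simp: fv.span_insert)
  moreover have "card (insert v W) \<le> Suc k"
    using W by (simp add: card_insert_if)
  ultimately show ?thesis
    unfolding comb_def using W assms by (intro exI[of _ "insert v W"]) auto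
qed

lemma blks_mono: "n \<le> m \<Longrightarrow> blks n \<subseteq> blks m"
  by (auto simp: blks_def)

lemma blk_mem_blks: "u < n \<Longrightarrow> blk u a \<in> blks n"
  by (auto simp: blks_def)

lemma ext4:
  fixes x y :: "nat \<Rightarrow> 'a"
  assumes "\<And>i. i < 2*n \<Longrightarrow> x i = y i" "x (2*n) = y (2*n)" "x (2*n+1) = y (2*n+1)"
    "x (2*n+2) = y (2*n+2)" "x (2*n+3) = y (2*n+3)" "\<And>i. i \<ge> 2*n+4 \<Longrightarrow> x i = y i"
  shows "x = y"
proof
  fix i
  consider "i < 2*n" | "i = 2*n" | "i = 2*n+1" | "i = 2*n+2" | "i = 2*n+3" | "i \<ge> 2*n+4"
    by linarith
  then show "x i = y i" using assms by cases auto
qed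

section \<open>Combinations of two vectors of one block\<close>

text \<open>Multiplication by \<open>x\<close> permutes the nonzero elements; comparing their
  products gives x^3 = 1, hence x = x^4.\<close>

lemma square_root_card_4:
  fixes x :: "'a::{field,finite}"
  assumes "CARD('a) = 4" "x \<noteq> 0"
  shows "\<exists>a. a \<noteq> 0 \<and> a\<^sup>2 = x"
proof -
  let ?P = "\<Prod>z\<in>UNIV-{0::'a}. z"
  have "bij_betw ((*) x) (UNIV-{0}) (UNIV-{0})"
    by (rule bij_betw_byWitness[where f' = "\<lambda>z. z / x"]) (use assms(2) in auto)
  then have "?P = (\<Prod>z\<in>UNIV-{0}. x * z)"
    using prod.reindex_bij_betw[of "(*) x" _ _ "\<lambda>z. z"] by simp
  also have "\<dots> = x ^ 3 * ?P"
    using assms(1) by (simp add: prod.distrib card_Diff_singleton)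
  finally have "x ^ 3 = 1" by simp
  then have "(x\<^sup>2)\<^sup>2 = x"
    by (simp add: power2_eq_square power3_eq_cube mult.assoc)
  with assms(2) show ?thesis by (intro exI[of _ "x\<^sup>2"]) auto
qed

text \<open>The linear form (ab, -(a+b), 1) comes from the coefficients of (X-a)(X-b), so it
  vanishes on (1,a,a^2) and (1,b,b^2), and its kernel is their span.\<close>

lemma conic_chord:
  fixes a b m s t :: "'a::field"
  assumes "a \<noteq> b" "m*a*b - s*(a+b) + t = 0"
  obtains \<alpha> \<beta> where "\<alpha> + \<beta> = m" "\<alpha>*a + \<beta>*b = s" "\<alpha>*a\<^sup>2 + \<beta>*b\<^sup>2 = t"
proof -
  define \<beta> where "\<beta> = (s - m*a) / (b - a)"
  define \<alpha> where "\<alpha> = m - \<beta>"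
  have \<beta>: "\<beta> * (b - a) = s - m*a" using assms(1) by (simp add: \<beta>_def)
  have 1: "\<alpha> + \<beta> = m" by (simp add: \<alpha>_def)
  have 2: "\<alpha>*a + \<beta>*b = s" using \<beta> by (simp add: \<alpha>_def algebra_simps)
  have "\<alpha>*a\<^sup>2 + \<beta>*b\<^sup>2 = (\<alpha>*a + \<beta>*b) * (a + b) - (\<alpha> + \<beta>)*a*b"
    by (simp add: algebra_simps power2_eq_square)
  also have "\<dots> = t" using assms(2) unfolding 1 2 by (simp add: algebra_simps)
  finally show thesis using that 1 2 by blast
qed

text \<open>The chord through the conic points with parameters \<open>a\<close> and \<open>b\<close> contains \<open>(m, s, t)\<close> iff
  \<open>m a b - s (a + b) + t = 0\<close>. Solving for \<open>b\<close> fails for at most five values of \<open>a\<close>; for \<open>q = 4\<close>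
  there are either at most three such values, or \<open>m, t \<noteq> 0\<close> and, \<open>t / m\<close> being a square,
  \<open>blk u 0\<close> and one conic point suffice.\<close>

lemma two_points_of_block:
  fixes m s t :: "'a::{field,finite}"
  assumes q: "CARD('a) = 4 \<or> CARD('a) \<ge> 7"
    and two: "m \<noteq> 0 \<and> s \<noteq> 0 \<or> m \<noteq> 0 \<and> t \<noteq> 0 \<or> s \<noteq> 0 \<and> t \<noteq> 0"
  obtains a b \<alpha> \<beta> where
    "\<And>n. \<alpha> * blk (Suc n) a (2*n+1) + \<beta> * blk (Suc n) b (2*n+1) = m"
    "\<And>n. \<alpha> * blk (Suc n) a (2*n+2) + \<beta> * blk (Suc n) b (2*n+2) = s"
    "\<And>n. \<alpha> * blk (Suc n) a (2*n+3) + \<beta> * blk (Suc n) b (2*n+3) = t"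
proof (cases "CARD('a) = 4 \<and> m \<noteq> 0 \<and> t \<noteq> 0")
  case True
  then obtain a where a: "a \<noteq> 0" "a\<^sup>2 = t / m"
    using square_root_card_4[of "t / m"] by auto
  \<comment> \<open>\<open>m\<close> times the conic point has the right outer coordinates, and
    \<open>blk (Suc n) 0\<close> corrects the middle one.\<close>
  show thesis
    by (rule that[of m a "s - m*a" 0]) (use a True in \<open>auto simp: blk_Suc\<close>)
next
  case False
  \<comment> \<open>The parameters for which the solution \<open>b\<close> of the chord equation
    would equal \<open>a\<close>.\<close>
  define R where "R = {a. poly [:t, -2*s, m:] a = 0}"
  have R: "a \<in> R \<longleftrightarrow> m*a\<^sup>2 - 2*s*a + t = 0" for a
    by (auto simp: R_def algebra_simps power2_eq_square)
  have nz: "[:t, -2*s, m:] \<noteq> 0" using two by auto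
  have cR: "card R \<le> degree [:t, -2*s, m:]"
    unfolding R_def by (rule card_poly_roots_bound[OF nz])
  \<comment> \<open>Besides \<open>R\<close>: 0 is no conic parameter, \<open>s/m\<close> makes the
    denominator of \<open>b\<close> vanish, and \<open>t/s\<close> would give \<open>b = 0\<close>.
    A quotient by zero is 0 and adds nothing.\<close>
  define X where "X = {0, s/m, t/s} \<union> R"
  have "card X < CARD('a)"
  proof (cases "CARD('a) = 4")
    case True
    with False two have s: "s \<noteq> 0" and mt: "m = 0 \<or> t = 0" by auto
    \<comment> \<open>For \<open>m = 0\<close> the value \<open>s/m\<close> is 0 and the polynomial
      has degree at most 1; for \<open>t = 0\<close> the value \<open>t/s\<close> is 0, and so is
      one of the possible roots.\<close>
    have "card X \<le> 3"
    proof (cases "m = 0")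
      case m: True
      have "card X \<le> card {0, t/s} + card R"
        unfolding X_def m using card_Un_le[of "{0, t/s}" R] by simp
      moreover have "card {0, t/s} \<le> 2" by (simp add: card_insert_if)
      moreover have "card R \<le> 1" using cR m by (auto intro: order_trans split: if_splits)
      ultimately show ?thesis by linarith
    next
      case m: False
      with mt have t: "t = 0" by simp
      have "a = 0 \<or> a = 2*s/m" if "a \<in> R" for a
      proof -
        have "a * (m*a - 2*s) = 0" using that t by (simp add: R algebra_simps power2_eq_square)
        then show ?thesis using m by (auto simp: field_simps)
      qed
      then have "X \<subseteq> {0, s/m, 2*s/m}" unfolding X_def t by auto
      then have "card X \<le> card {0, s/m, 2*s/m}" by (rule card_mono[rotated]) simp
      also have "\<dots> \<le> 3" by (simp add: card_insert_if)
      finally show ?thesis .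
    qed
    with True show ?thesis by simp
  next
    case False
    with q have "CARD('a) \<ge> 7" by simp
    moreover have "card X \<le> card {0, s/m, t/s} + card R" unfolding X_def by (rule card_Un_le)
    moreover have "card {0, s/m, t/s} \<le> 3" by (simp add: card_insert_if)
    moreover have "card R \<le> 2" using cR by (auto intro: order_trans split: if_splits)
    ultimately show ?thesis by linarith
  qed
  then have "X \<noteq> UNIV" by auto
  then obtain a where aX: "a \<notin> X" by auto
  then have a: "a \<noteq> 0" "a \<noteq> s/m" "a \<noteq> t/s" and ar: "m*a\<^sup>2 - 2*s*a + t \<noteq> 0"
    using R by (auto simp: X_def)
  have d: "m*a - s \<noteq> 0" using a two by (cases "m = 0") (auto simp: field_simps)
  have e: "s*a - t \<noteq> 0" using a two by (cases "s = 0") (auto simp: field_simps)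
  define b where "b = (s*a - t) / (m*a - s)"
  have b: "b * (m*a - s) = s*a - t" "b \<noteq> 0" using d e by (auto simp: b_def)
  have "a \<noteq> b"
  proof
    assume "a = b"
    with b(1) have "a * (m*a - s) = s*a - t" by simp
    with ar show False by (simp add: algebra_simps power2_eq_square)
  qed
  moreover have "m*a*b - s*(a+b) + t = 0" using b(1) by (simp add: algebra_simps)
  ultimately obtain \<alpha> \<beta> where "\<alpha> + \<beta> = m" "\<alpha>*a + \<beta>*b = s" "\<alpha>*a\<^sup>2 + \<beta>*b\<^sup>2 = t"
    by (rule conic_chord)
  with a b show thesis by (intro that[of \<alpha> a \<beta> b]) (auto simp: blk_Suc)
qed

section \<open>Upper bounds\<close>

text \<open>Since \<open>x (2*n) = 0\<close>, \<open>x\<close> is the sum of its first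
  \<open>2*n\<close> coordinates and a vector in the plane of block \<open>Suc n\<close>, to which
  \<open>two_points_of_block\<close> applies.\<close>

lemma comb_two_of_block:
  fixes x :: "nat \<Rightarrow> 'a::{field,finite}"
  assumes q: "CARD('a) = 4 \<or> CARD('a) \<ge> 7"
    and c: "comb (blks n) k (truncate (2*n) x)" and x: "x \<in> vecs (2*n+4)" "x (2*n) = 0"
    and two: "x (2*n+1) \<noteq> 0 \<and> x (2*n+2) \<noteq> 0 \<or> x (2*n+1) \<noteq> 0 \<and> x (2*n+3) \<noteq> 0 \<or>
      x (2*n+2) \<noteq> 0 \<and> x (2*n+3) \<noteq> 0"
  shows "comb (blks (n+2)) (k+2) x"
proof -
  from two_points_of_block[OF q two] obtain a b \<alpha> \<beta> where
    h: "\<alpha> * blk (Suc n) a (2*n+1) + \<beta> * blk (Suc n) b (2*n+1) = x (2*n+1)"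
    "\<alpha> * blk (Suc n) a (2*n+2) + \<beta> * blk (Suc n) b (2*n+2) = x (2*n+2)"
    "\<alpha> * blk (Suc n) a (2*n+3) + \<beta> * blk (Suc n) b (2*n+3) = x (2*n+3)" by metis
  have "x - \<alpha> \<cdot>\<^sub>v blk (Suc n) a - \<beta> \<cdot>\<^sub>v blk (Suc n) b = truncate (2*n) x"
  proof (rule ext4[where n = n], goal_cases)
    case (6 i)
    then show ?case using x by (simp add: vecs_def vscale_def truncate_def blk_Suc)
  qed (use x h[symmetric] in \<open>simp_all add: vscale_def truncate_def blk_Suc\<close>)
  with c have "comb (blks n) k (x - \<alpha> \<cdot>\<^sub>v blk (Suc n) a - \<beta> \<cdot>\<^sub>v blk (Suc n) b)" by simp
  then have "comb (blks (n+2)) (Suc k) (x - \<alpha> \<cdot>\<^sub>v blk (Suc n) a)"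
    by (rule comb_add) (auto intro!: blk_mem_blks blks_mono simp del: add_2_eq_Suc')
  then have "comb (blks (n+2)) (Suc (Suc k)) x"
    by (rule comb_add) (auto intro: blk_mem_blks)
  then show ?thesis by simp
qed

text \<open>The two bounds need a joint induction: when the last two coordinates vanish, the first
  bound follows from the second for one block less.\<close>

lemma comb_blks:
  assumes q: "CARD('a::{field,finite}) = 4 \<or> CARD('a) \<ge> 7"
  shows "(\<forall>x :: nat \<Rightarrow> 'a. x \<in> vecs (2*n) \<longrightarrow> (x \<notin> Mv n \<longrightarrow> comb (blks n) n x) \<and> comb (blks n) (n+1) x)"
proof (induction n rule: induct_nat_012)
  case 0
  then show ?case by (auto simp: vecs_def comb_0 simp flip: zero_fun_def fun_eq_iff
      dest!: ext[where g = "\<lambda>_. 0"])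
next
  case 1
  have one: "comb (blks 1) 1 x" if x: "x \<in> vecs 2" "x 0 \<noteq> 0" for x :: "nat \<Rightarrow> 'a"
  proof -
    have "x - x 0 \<cdot>\<^sub>v blk 0 (x 1 / x 0) = 0"
      using x by (auto simp: fun_eq_iff vscale_def blk_0 vecs_def)
    with comb_add[where V = "blks 1" and k = 0 and c = "x 0" and v = "blk 0 (x 1 / x 0)"]
    show ?thesis by (simp add: comb_0 blk_mem_blks)
  qed
  have two: "comb (blks 1) 2 x" if x: "x \<in> vecs 2" for x :: "nat \<Rightarrow> 'a"
  proof (cases "x 0 = 0")
    case True
    \<comment> \<open>Adding e_0 makes coordinate 0 nonzero, at the cost of one vector.\<close>
    let ?z = "x - (-1) \<cdot>\<^sub>v blk 0 0"
    have "?z \<in> vecs 2" "?z 0 \<noteq> 0" using x True by (auto simp: vscale_def blk_0 vecs_def)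
    then show ?thesis using comb_add[OF one[of ?z], of "blks 1"]
      by (simp add: blk_mem_blks numeral_2_eq_2)
  next
    case False
    then show ?thesis using comb_mono[OF one] x by auto
  qed
  have "comb (blks 1) 1 x" if x: "x \<in> vecs 2" "x \<notin> Mv 1" for x :: "nat \<Rightarrow> 'a"
  proof (cases "x 0 = 0")
    case True
    with x have "x 1 = 0" by (auto simp: Mv_def)
    with x True have "x i = 0" for i
      by (cases "i \<ge> 2") (auto simp: vecs_def less_2_cases_iff not_le)
    then have "x = 0" by auto
    then show ?thesis by (simp add: comb_0)
  qed (use one x in auto)
  with two show ?case by (simp add: numeral_2_eq_2)
next
  case (ge2 n)
  have P0: "comb (blks n) n x" if "x \<in> vecs (2*n)" "x \<notin> Mv n" for x :: "nat \<Rightarrow> 'a" using ge2 that by blast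
  have P1: "comb (blks (Suc n)) (Suc n) x" if "x \<in> vecs (2*n+2)" "x \<notin> Mv (Suc n)" for x :: "nat \<Rightarrow> 'a"
    using ge2 that by auto
  have Q1: "comb (blks (Suc n)) (n+2) x" if "x \<in> vecs (2*n+2)" for x :: "nat \<Rightarrow> 'a"
    using ge2 that by auto
  {
    fix x :: "nat \<Rightarrow> 'a" assume x: "x \<in> vecs (2*n+4)"
    let ?y = "truncate (2*n+2) x" and ?y' = "truncate (2*n) x"
    have yv: "?y \<in> vecs (2*n+2)" "?y' \<in> vecs (2*n)" by (rule truncate_in_vecs)+
    have tt: "truncate (2*n) ?y = ?y'" "truncate (2*n) (?y - l \<cdot>\<^sub>v unit_vec (2*n+1)) = ?y'" for l
      by (auto simp: truncate_def fun_eq_iff vscale_def unit_vec_def)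
    have My: "?y \<in> Mv (Suc n) \<longleftrightarrow> ?y' \<notin> Mv n \<and> x (2*n) = 0 \<and> x (2*n+1) \<noteq> 0"
    proof -
      have "?y (2*n) = x (2*n)" "?y (2*n+1) = x (2*n+1)" by (simp_all add: truncate_def)
      with yv(1) show ?thesis unfolding mem_Mv_Suc tt by simp
    qed
    have Mx: "x \<in> Mv (Suc (Suc n)) \<longleftrightarrow> ?y \<notin> Mv (Suc n) \<and> x (2*n+2) = 0 \<and> x (2*n+3) \<noteq> 0"
      using x by (simp add: mem_Mv_Suc[of _ "Suc n"] eval_nat_numeral)
    \<comment> \<open>\<open>l\<close> is the contribution of a vector of block \<open>Suc n\<close>
      to the shared coordinate \<open>2*n+1\<close>. Under this condition no choice of
      \<open>l\<close> leads into \<open>Mv (Suc n)\<close>.\<close>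
    have Py: "comb (blks (Suc n)) (Suc n) (?y - l \<cdot>\<^sub>v unit_vec (2*n+1))"
      if "\<not> (?y' \<notin> Mv n \<and> x (2*n) = 0)" for l
    proof (rule P1)
      show "?y - l \<cdot>\<^sub>v unit_vec (2*n+1) \<in> vecs (2*n+2)"
        by (auto simp: vecs_def truncate_def vscale_def unit_vec_def)
      show "?y - l \<cdot>\<^sub>v unit_vec (2*n+1) \<notin> Mv (Suc n)"
        using that unfolding mem_Mv_Suc tt by (auto simp: truncate_def vscale_def unit_vec_def)
    qed
    have mono: "blks n \<subseteq> blks (n+2)" "blks (Suc n) \<subseteq> blks (n+2)" by (simp_all add: blks_mono)
    have bm: "blk (Suc n) a \<in> blks (n+2)" for a :: 'a by (simp add: blk_mem_blks)
    have P: "comb (blks (n+2)) (n+2) x" if xM: "x \<notin> Mv (Suc (Suc n))"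
    proof (cases "?y' \<notin> Mv n \<and> x (2*n) = 0")
      case True
      then have c: "comb (blks n) n ?y'" using P0 yv by blast
      \<comment> \<open>With (m, s, t) the last three coordinates: either two are nonzero, or at
        most m, at most s, or exactly t is.\<close>
      consider (two) "x (2*n+1) \<noteq> 0 \<and> x (2*n+2) \<noteq> 0 \<or> x (2*n+1) \<noteq> 0 \<and> x (2*n+3) \<noteq> 0 \<or>
          x (2*n+2) \<noteq> 0 \<and> x (2*n+3) \<noteq> 0" | (y) "x (2*n+2) = 0" "x (2*n+3) = 0"
        | (s) "x (2*n+1) = 0" "x (2*n+3) = 0" | (t) "x (2*n+1) = 0" "x (2*n+2) = 0" "x (2*n+3) \<noteq> 0"
        by blast
      then show ?thesis
      proof cases
        case two
        then show ?thesis using comb_two_of_block[OF q c x] True by blast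
      next
        case y
        have "?y = x"
          by (rule ext4[where n = n]) (use x y in \<open>auto simp: truncate_def vecs_def\<close>)
        then show ?thesis using comb_mono[OF Q1[OF yv(1)] mono(2)] by simp
      next
        case s
        have "x - x (2*n+2) \<cdot>\<^sub>v blk (Suc n) 0 = ?y'"
          by (rule ext4[where n = n])
            (use x s True in \<open>auto simp: truncate_def vecs_def vscale_def blk_Suc\<close>)
        then have "comb (blks (n+2)) (Suc n) x"
          using comb_add[of "blks n" n x "x (2*n+2)" "blk (Suc n) 0", OF _ mono(1) bm] c by simp
        then show ?thesis by (rule comb_mono) auto
      next
        case t
        \<comment> \<open>Here m = 0 keeps \<open>?y\<close> outside \<open>Mv (Suc n)\<close>, so
          \<open>x\<close> would lie in \<open>Mv (Suc (Suc n))\<close>.\<close>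
        then show ?thesis using xM Mx My by auto
      qed
    next
      case False
      show ?thesis
      proof (cases "x (2*n+3) = 0")
        case True
        have "x - x (2*n+2) \<cdot>\<^sub>v blk (Suc n) 0 = ?y - 0 \<cdot>\<^sub>v unit_vec (2*n+1)"
          by (rule ext4[where n = n])
            (use x True in \<open>auto simp: truncate_def vecs_def vscale_def blk_Suc\<close>)
        then have "comb (blks (n+2)) (Suc (Suc n)) x"
          using comb_add[of "blks (Suc n)" "Suc n" x "x (2*n+2)" "blk (Suc n) 0", OF _ mono(2) bm]
            Py[OF False, of 0] by simp
        then show ?thesis by simp
      next
        case t: False
        with xM Mx My False have s: "x (2*n+2) \<noteq> 0" by auto
        \<comment> \<open>Chosen so that l(1, a, a^2) = (l, s, t), with s and t the last two
          coordinates.\<close>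
        let ?a = "x (2*n+3) / x (2*n+2)" and ?l = "(x (2*n+2))\<^sup>2 / x (2*n+3)"
        have "x - ?l \<cdot>\<^sub>v blk (Suc n) ?a = ?y - ?l \<cdot>\<^sub>v unit_vec (2*n+1)"
          by (rule ext4[where n = n])
            (use x s t in \<open>auto simp: truncate_def vecs_def vscale_def blk_Suc unit_vec_def power2_eq_square\<close>)
        then have "comb (blks (n+2)) (Suc (Suc n)) x"
          using comb_add[of "blks (Suc n)" "Suc n" x ?l "blk (Suc n) ?a", OF _ mono(2) bm]
            Py[OF False, of ?l] by simp
        then show ?thesis by simp
      qed
    qed
    have "comb (blks (n+2)) (n+3) x"
    proof (cases "x \<in> Mv (Suc (Suc n))")
      case False
      then show ?thesis using comb_mono[OF P] by auto
    next
      case True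
      then have m: "?y \<notin> Mv (Suc n)" "x (2*n+2) = 0" "x (2*n+3) \<noteq> 0" by (simp_all add: Mx)
      show ?thesis
      proof (cases "?y' \<notin> Mv n \<and> x (2*n) = 0")
        case True
        then have c: "comb (blks n) n ?y'" using P0 yv by blast
        \<comment> \<open>\<open>(0, 0, t)\<close> is not on a chord, but \<open>(0, 1, t)\<close> is.\<close>
        let ?z = "x - (-1) \<cdot>\<^sub>v blk (Suc n) 0"
        have zz: "truncate (2*n) ?z = ?y'" "?z \<in> vecs (2*n+4)"
          using x by (auto simp: fun_eq_iff truncate_def vscale_def blk_Suc vecs_def)
        have z: "?z (2*n) = 0" "?z (2*n+2) \<noteq> 0 \<and> ?z (2*n+3) \<noteq> 0"
          using m True by (auto simp: vscale_def blk_Suc)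
        have "comb (blks (n+2)) (n+2) ?z"
          by (rule comb_two_of_block[where x = ?z and n = n, OF q _ zz(2) z(1)]) (use zz c z in auto)
        then have "comb (blks (n+2)) (Suc (n+2)) x" by (rule comb_add[OF _ order_refl bm])
        then show ?thesis by (simp add: eval_nat_numeral)
      next
        case False
        let ?t = "x (2*n+3)"
        \<comment> \<open>The difference of \<open>blk (Suc n) 1\<close> and
          \<open>blk (Suc n) 0\<close> is (1,1,1) - (0,1,0) = (1,0,1), so two vectors supply the
          last coordinate.\<close>
        have "x - (- ?t) \<cdot>\<^sub>v blk (Suc n) 0 - ?t \<cdot>\<^sub>v blk (Suc n) 1 = ?y - ?t \<cdot>\<^sub>v unit_vec (2*n+1)"
          by (rule ext4[where n = n])
            (use x m in \<open>auto simp: truncate_def vecs_def vscale_def blk_Suc unit_vec_def\<close>)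
        with Py[OF False, of ?t]
        have "comb (blks (Suc n)) (Suc n) (x - (- ?t) \<cdot>\<^sub>v blk (Suc n) 0 - ?t \<cdot>\<^sub>v blk (Suc n) 1)" by simp
        from comb_add[OF comb_add[OF this mono(2) bm] order_refl bm]
        show ?thesis by (simp add: eval_nat_numeral)
      qed
    qed
    note P this
  }
  then show ?case by (simp add: eval_nat_numeral)
qed


section \<open>From points to vectors\<close>

definition Svecs :: "nat \<Rightarrow> (nat \<Rightarrow> 'a::field) set" where
  "Svecs \<rho> = insert (unit_vec (2*\<rho>+1)) (blks (Suc \<rho>))"

text \<open>Allows cardinalities and the removal of a point to be computed on the chosen vectors: no
  two of them are proportional.\<close>

lemma inj_on_point_Svecs: "inj_on point (Svecs \<rho> :: (nat \<Rightarrow> 'a::field) set)"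
proof (rule inj_onI)
  fix v w :: "nat \<Rightarrow> 'a"
  assume v: "v \<in> Svecs \<rho>" and w: "w \<in> Svecs \<rho>" and e: "point v = point w"
  have "v \<in> point w" "w \<in> point v"
    using e unfolding point_def by (metis fv.span_base singletonI)+
  then have "\<exists>k. v = k \<cdot>\<^sub>v w" "\<exists>l. w = l \<cdot>\<^sub>v v"
    unfolding point_def fv.span_singleton by blast+
  then obtain k l where kl: "v = k \<cdot>\<^sub>v w" "w = l \<cdot>\<^sub>v v" by blast
  show "v = w"
  proof (cases "v = unit_vec (2*\<rho>+1)")
    case True
    with kl(2) blk_noteq_unit_odd have "w \<noteq> blk u a" for u a by metis
    then have "w \<notin> blks (Suc \<rho>)" by (auto simp: blks_def)
    with w True show ?thesis by (simp add: Svecs_def)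
  next
    case False
    with v obtain u a where v': "v = blk u a" by (auto simp: Svecs_def blks_def)
    with kl(1) have "w \<noteq> unit_vec (2*\<rho>+1)" using blk_noteq_unit_odd by metis
    with w obtain u' a' where w': "w = blk u' a'" by (auto simp: Svecs_def blks_def)
    show ?thesis using blk_scale_inj[OF kl(1)[unfolded v' w']] v' w' by simp
  qed
qed

lemma S_set_eq: "S_set \<rho> = point ` Svecs \<rho>"
proof -
  have r0: "range (blk 0) = {unit_vec 0} \<union> {unit_vec 0 + a \<cdot>\<^sub>v unit_vec 1 | a::'a. a \<noteq> 0}"
  proof -
    have b: "blk 0 a = unit_vec 0 + a \<cdot>\<^sub>v unit_vec 1" "blk 0 0 = (unit_vec 0 :: nat \<Rightarrow> 'a)" for a :: 'a
      by (simp_all add: blk_def fun_eq_iff vscale_def)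
    have "range (blk 0 :: 'a \<Rightarrow> _) = {blk 0 0} \<union> {blk 0 a | a::'a. a \<noteq> 0}" by blast
    \<comment> \<open>\<open>b(2)\<close> must come first, since \<open>b(1)\<close> would also
      rewrite \<open>blk 0 0\<close>.\<close>
    then show ?thesis by (simp only: b(2)) (simp only: b(1))
  qed
  have ru: "range (blk u) = {unit_vec (2*u - 1) + a \<cdot>\<^sub>v unit_vec (2*u) + a\<^sup>2 \<cdot>\<^sub>v unit_vec (2*u + 1) | a::'a. a \<noteq> 0} \<union> {unit_vec (2*u)}"
    if "u \<in> {1..\<rho>}" for u
    using that by (auto simp: blk_def image_iff)
  have "blks (Suc \<rho>) = range (blk 0 :: 'a \<Rightarrow> _) \<union> (\<Union>u\<in>{1..\<rho>}. range (blk u))"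
  proof -
    have "{..<Suc \<rho>} = insert 0 {1..\<rho>}" by auto
    moreover have "blks (Suc \<rho>) = (\<Union>u\<in>{..<Suc \<rho>}. range (blk u :: 'a \<Rightarrow> _))" by (auto simp: blks_def)
    ultimately show ?thesis by (simp only: UN_insert)
  qed
  also have "(\<Union>u\<in>{1..\<rho>}. range (blk u :: 'a \<Rightarrow> _)) = (\<Union>u\<in>{1..\<rho>}.
      {unit_vec (2*u - 1) + a \<cdot>\<^sub>v unit_vec (2*u) + a\<^sup>2 \<cdot>\<^sub>v unit_vec (2*u + 1) | a::'a. a \<noteq> 0} \<union> {unit_vec (2*u)})"
    by (intro SUP_cong refl ru)
  finally show ?thesis
    unfolding S_set_def Svecs_def r0 by (simp only: Un_insert_right Un_empty_right)
qed

lemma unit_notin_blks: "unit_vec (2*\<rho>+1) \<notin> blks n"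
proof
  assume "unit_vec (2*\<rho>+1) \<in> (blks n :: (nat \<Rightarrow> 'a) set)"
  then obtain u and a :: 'a where "blk u a = unit_vec (2*\<rho>+1)" by (auto simp: blks_def)
  then show False using blk_noteq_unit_odd[of u a 1 \<rho>] by (simp add: vscale_def)
qed

lemma S_minus_eq: "S_minus \<rho> = point ` blks (Suc \<rho>)"
proof -
  have "S_minus \<rho> = point ` Svecs \<rho> - point ` {unit_vec (2*\<rho>+1)}"
    by (simp add: S_minus_def S_set_eq)
  also have "\<dots> = point ` (Svecs \<rho> - {unit_vec (2*\<rho>+1)})"
    by (rule inj_on_image_set_diff[OF inj_on_point_Svecs, symmetric]) (auto simp: Svecs_def)
  also have "Svecs \<rho> - {unit_vec (2*\<rho>+1)} = blks (Suc \<rho>)"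
    using unit_notin_blks by (auto simp: Svecs_def)
  finally show ?thesis .
qed

lemma card_blks: "card (blks n :: (nat \<Rightarrow> 'a::{field,finite}) set) = n * CARD('a)"
proof -
  have "blks n = (\<lambda>(u, a::'a). blk u a) ` ({..<n} \<times> UNIV)"
    by (auto simp: blks_def)
  moreover have "inj (\<lambda>(u, a::'a). blk u a)"
    by (auto simp: inj_on_def dest: blk_inj)
  ultimately show ?thesis
    by (simp add: card_image inj_on_subset)
qed

lemma finite_blks: "finite (blks n :: (nat \<Rightarrow> 'a::{field,finite}) set)"
proof -
  have "blks n = (\<lambda>(u, a::'a). blk u a) ` ({..<n} \<times> UNIV)"
    by (auto simp: blks_def)
  then show ?thesis by simp
qed

lemma span_Union_point: "fv.span (\<Union>(point ` W)) = fv.span W"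
proof
  show "fv.span (\<Union>(point ` W)) \<subseteq> fv.span W"
  proof (rule fv.span_minimal)
    have "point w \<subseteq> fv.span W" if "w \<in> W" for w
      unfolding point_def by (rule fv.span_mono) (use that in simp)
    then show "\<Union>(point ` W) \<subseteq> fv.span W" by blast
  qed simp
  show "fv.span W \<subseteq> fv.span (\<Union>(point ` W))"
    by (rule fv.span_mono) (auto simp: point_def intro: fv.span_base)
qed

lemma point_subset_span: "point x \<subseteq> fv.span W \<longleftrightarrow> x \<in> fv.span W"
  unfolding point_def
  by (metis empty_subsetI fv.span_base fv.span_minimal fv.subspace_span insert_subset singletonI subset_iff)

text \<open>Counts agree because a set of points from the image lifts to one representative each,
  and passing to points cannot increase cardinality.\<close>

lemma lin_comb_point: "lin_comb_of_at_most k (point ` V) (point x) \<longleftrightarrow> comb V k x"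
proof
  assume "lin_comb_of_at_most k (point ` V) (point x)"
  then obtain T where T: "T \<subseteq> point ` V" "finite T" "card T \<le> k" "point x \<subseteq> fv.span (\<Union>T)"
    by (auto simp: lin_comb_of_at_most_def)
  from T(1) obtain W where W: "W \<subseteq> V" "inj_on point W" "T = point ` W"
    by (auto simp: subset_image_inj)
  with T show "comb V k x"
    unfolding comb_def
    by (intro exI[of _ W])
      (auto simp: card_image finite_image_iff span_Union_point point_subset_span)
next
  assume "comb V k x"
  then obtain W where W: "W \<subseteq> V" "finite W" "card W \<le> k" "x \<in> fv.span W"
    by (auto simp: comb_def)
  then show "lin_comb_of_at_most k (point ` V) (point x)"
    unfolding lin_comb_of_at_most_def
    by (intro exI[of _ "point ` W"])
      (auto simp: span_Union_point point_subset_span intro: order_trans[OF card_image_le])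
qed

section \<open>Lower bounds\<close>

lemma span_coord_zero:
  assumes "x \<in> fv.span W" "\<And>w. w \<in> W \<Longrightarrow> w i = 0"
  shows "x i = 0"
proof -
  have "fv.subspace {x. x i = 0}"
    by (auto simp: fv.subspace_def vscale_def)
  then have "fv.span W \<subseteq> {x. x i = 0}"
    using assms(2) by (intro fv.span_minimal) auto
  with assms(1) show ?thesis by auto
qed

lemma block_used:
  assumes "W \<subseteq> Svecs \<rho>" "x \<in> fv.span W" "x (2*u) \<noteq> 0"
  shows "\<exists>a. blk u a \<in> W"
proof -
  obtain w where w: "w \<in> W" "w (2*u) \<noteq> 0"
    using span_coord_zero[OF assms(2)] assms(3) by blast
  have "unit_vec (2*\<rho>+1) (2*u) = (0 :: 'a)" by (simp add: unit_vec_def) presburger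
  with w assms(1) obtain u' a where "w = blk u' a"
    by (auto simp: Svecs_def blks_def)
  with w show ?thesis using blk_even_other[of u u' a] by auto
qed

text \<open>Choosing one vector per block gives \<open>Suc \<rho>\<close> distinct elements of
  \<open>W\<close>. If \<open>W\<close> is no larger, it consists of these alone, which also rules
  out e_{2 rho+1}.\<close>

lemma one_per_block:
  assumes "finite W" and used: "\<And>u. u \<le> \<rho> \<Longrightarrow> \<exists>a. blk u a \<in> W"
  shows "Suc \<rho> \<le> card W"
    and "card W \<le> Suc \<rho> \<Longrightarrow> \<exists>a. W = (\<lambda>u. blk u (a u)) ` {..\<rho>}"
proof -
  from used obtain a where a: "\<And>u. u \<le> \<rho> \<Longrightarrow> blk u (a u) \<in> W" by metis
  let ?I = "(\<lambda>u. blk u (a u)) ` {..\<rho>}"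
  have c: "card ?I = Suc \<rho>"
    by (subst card_image) (auto simp: inj_on_def dest: blk_inj)
  have I: "?I \<subseteq> W" using a by auto
  from card_mono[OF assms(1) I] c show "Suc \<rho> \<le> card W" by simp
  assume "card W \<le> Suc \<rho>"
  with c have "?I = W" by (intro card_seteq[OF assms(1) I]) simp
  then show "\<exists>a. W = (\<lambda>u. blk u (a u)) ` {..\<rho>}" by blast
qed

text \<open>Only block \<open>w\<close> reaches coordinate \<open>2*w\<close>. Coordinate
  \<open>2*w+1\<close> is also reached by block \<open>Suc w\<close>, unless that block is absent or
  represented by its e_{2w+2}; then the ratio is that of block \<open>w\<close>.\<close>

lemma span_transversal_coords:
  assumes "x \<in> fv.span ((\<lambda>u. blk u (a u)) ` {..\<rho>})" "w \<le> \<rho>"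
  shows "w = \<rho> \<or> a (Suc w) = 0 \<Longrightarrow> x (2*w+1) = a w * x (2*w)"
proof -
  \<comment> \<open>Sums with coefficients indexed by the blocks instead of by the vectors.\<close>
  define X where "X = {x. \<exists>d. \<forall>i. x i = (\<Sum>u\<le>\<rho>. d u * blk u (a u) i)}"
  have "fv.subspace X"
    unfolding fv.subspace_def X_def
  proof (safe, goal_cases)
    case 1
    show ?case by (rule exI[of _ "\<lambda>_. 0"]) simp
  next
    case (2 x y d e)
    then show ?case by (intro exI[of _ "\<lambda>u. d u + e u"]) (simp add: sum.distrib algebra_simps)
  next
    case (3 c x d)
    then show ?case
      by (intro exI[of _ "\<lambda>u. c * d u"]) (simp add: sum_distrib_left vscale_def mult.assoc)
  qed
  moreover have "blk u (a u) \<in> X" if "u \<le> \<rho>" for u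
  proof -
    have "blk u (a u) i = (\<Sum>v\<le>\<rho>. (if v = u then 1 else 0) * blk v (a v) i)" for i
      using that by (simp add: if_distrib[of "\<lambda>c. c * _"] cong: if_cong)
    then show ?thesis by (auto simp: X_def)
  qed
  ultimately have "fv.span ((\<lambda>u. blk u (a u)) ` {..\<rho>}) \<subseteq> X"
    by (intro fv.span_minimal) auto
  with assms(1) obtain d where d: "\<And>i. x i = (\<Sum>u\<le>\<rho>. d u * blk u (a u) i)"
    by (auto simp: X_def)
  assume l: "w = \<rho> \<or> a (Suc w) = 0"
  have "x (2*w) = (\<Sum>u\<in>{w}. d u * blk u (a u) (2*w))"
    unfolding d using assms(2)
    by (intro sum.mono_neutral_right) (auto simp: blk_even_other)
  moreover have "x (2*w+1) = (\<Sum>u\<in>{w}. d u * blk u (a u) (2*w+1))"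
    unfolding d
  proof (intro sum.mono_neutral_right ballI)
    fix u assume u: "u \<in> {..\<rho>} - {w}"
    show "d u * blk u (a u) (2*w+1) = 0"
    proof (cases "u = Suc w")
      case True
      with l u have "a u = 0" by auto
      with True show ?thesis by (simp only: blk_Suc_0_odd mult_zero_right)
    next
      case False
      with u have "blk u (a u) (2*w+1) = 0" by (intro blk_odd_other) auto
      then show ?thesis by (simp only: mult_zero_right)
    qed
  qed (use assms(2) in auto)
  ultimately show "x (2*w+1) = a w * x (2*w)"
    by (simp add: blk_odd del: One_nat_def add_Suc_right)
qed

text \<open>A vector whose coverage by \<open>S_set \<rho>\<close> forces the use of \<open>blk v a\<close>.\<close>

definition target :: "nat \<Rightarrow> nat \<Rightarrow> 'a::field \<Rightarrow> nat \<Rightarrow> 'a" where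
  "target \<rho> v a = (\<lambda>i. if even i \<and> i \<noteq> 2*v then (if i \<le> 2*\<rho> then 1 else 0) else blk v a i)"

lemma target_even: "v \<le> \<rho> \<Longrightarrow> u \<le> \<rho> \<Longrightarrow> target \<rho> v a (2*u) \<noteq> 0"
  by (auto simp: target_def blk_even_nonzero)

lemma target_odd: "target \<rho> v a (2*u+1) = blk v a (2*u+1)"
  by (simp add: target_def)

lemma target_in_vecs: "v \<le> \<rho> \<Longrightarrow> target \<rho> v a \<in> vecs (2*\<rho>+2)"
  using blk_in_vecs[of v "Suc \<rho>" a] by (auto simp: target_def vecs_def)

text \<open>\<open>W\<close> has one vector per block. The odd coordinates above block
  \<open>v\<close> are zero, so from the top down the parameters there are 0; then the ratio at
  block \<open>v\<close> must be \<open>a\<close>.\<close>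

lemma target_essential:
  assumes W: "W \<subseteq> Svecs \<rho>" "finite W" "card W \<le> Suc \<rho>" and v: "v \<le> \<rho>"
    and x: "target \<rho> v a \<in> fv.span W"
  shows "blk v a \<in> W"
proof -
  let ?x = "target \<rho> v a"
  have "\<exists>a. blk u a \<in> W" if "u \<le> \<rho>" for u
    using block_used[OF W(1) x target_even[OF v that]] .
  from one_per_block(2)[OF W(2) this W(3)] obtain f where f: "W = (\<lambda>u. blk u (f u)) ` {..\<rho>}"
    by blast
  note coords = span_transversal_coords[OF x[unfolded f]]
  have above: "f u = 0" if "v < u" "u \<le> \<rho>" for u
    using that
  proof (induction "\<rho> - u" arbitrary: u rule: less_induct)
    case less
    have "u = \<rho> \<or> f (Suc u) = 0" using less by (cases "u = \<rho>") auto
    from coords[OF less.prems(2) this] have "blk v a (2*u+1) = f u * ?x (2*u)"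
      by (simp only: target_odd)
    moreover have "blk v a (2*u+1) = 0" using less.prems by (intro blk_odd_other) auto
    ultimately show ?case using target_even[OF v less.prems(2), of a] by simp
  qed
  have "v = \<rho> \<or> f (Suc v) = 0" using above v by (cases "v = \<rho>") auto
  from coords[OF v this] have "a * blk v a (2*v) = f v * blk v a (2*v)"
    by (simp only: target_odd blk_odd) (simp add: target_def)
  then have "f v = a" using blk_even_nonzero[of v a] by simp
  with f v show ?thesis by auto
qed

text \<open>The last coordinate forces a vector of block \<open>\<rho>\<close> as well, so
  \<open>W\<close> has exactly one per block; the top ratio then makes \<open>x (2*\<rho>+1)\<close>
  a multiple of \<open>x (2*\<rho>) = 0\<close>.\<close>

lemma not_in_span_blks:
  assumes "W \<subseteq> blks (Suc \<rho>)" "finite W" "card W \<le> Suc \<rho>"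
    and x: "x (2*\<rho>) = 0" "x (2*\<rho>+1) \<noteq> 0" and used: "\<And>u. u < \<rho> \<Longrightarrow> \<exists>a. blk u a \<in> W"
  shows "x \<notin> fv.span W"
proof
  assume s: "x \<in> fv.span W"
  obtain w where w: "w \<in> W" "w (2*\<rho>+1) \<noteq> 0" using span_coord_zero[OF s] x(2) by blast
  with assms(1) obtain u a where u: "w = blk u a" "u \<le> \<rho>" by (auto simp: blks_def)
  with w have "u = \<rho>" using blk_odd_other[of \<rho> u a] by force
  with u w used have "\<exists>a. blk u a \<in> W" if "u \<le> \<rho>" for u
    using that by (cases "u = \<rho>") auto
  from one_per_block(2)[OF assms(2) this assms(3)] obtain f where "W = (\<lambda>u. blk u (f u)) ` {..\<rho>}"
    by blast
  from span_transversal_coords[OF s[unfolded this], of \<rho>] x show False by simp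
qed

lemma not_comb_blks:
  assumes "x (2*\<rho>) = 0" "x (2*\<rho>+1) \<noteq> 0" "\<And>u. u < \<rho> \<Longrightarrow> x (2*u) \<noteq> 0"
  shows "\<not> comb (blks (Suc \<rho>)) (Suc \<rho>) x"
proof
  assume "comb (blks (Suc \<rho>)) (Suc \<rho>) x"
  then obtain W where W: "W \<subseteq> blks (Suc \<rho>)" "finite W" "card W \<le> Suc \<rho>" "x \<in> fv.span W"
    by (auto simp: comb_def)
  have "\<exists>a. blk u a \<in> W" if "u < \<rho>" for u
    by (rule block_used[OF _ W(4) assms(3)[OF that], of \<rho>]) (use W in \<open>auto simp: Svecs_def\<close>)
  with not_in_span_blks[OF W(1-3) assms(1,2)] W(4) show False by blast
qed

text \<open>Covers the multiples of e_3, which do not force the use of block 0. Without block 0, the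
  point (0,0,1) of the conic plane would have to lie on a line joining two points of block
  1.\<close>

lemma not_comb_blks_2:
  assumes x: "x 0 = 0" "x 1 = 0" "x 2 = 0" "x 3 \<noteq> 0"
  shows "\<not> comb (blks 2) 2 (x :: nat \<Rightarrow> 'a::field)"
proof
  assume "comb (blks 2) 2 x"
  then obtain W where W: "W \<subseteq> blks 2" "finite W" "card W \<le> 2" "x \<in> fv.span W"
    by (auto simp: comb_def)
  show False
  proof (cases "\<exists>a. blk 0 a \<in> W")
    case True
    then show False using not_in_span_blks[of W 1 x] W x
      by (auto simp: numeral_2_eq_2 numeral_3_eq_3)
  next
    case False
    then have W1: "W \<subseteq> range (blk (Suc 0))"
    proof (intro subsetI)
      fix w assume "w \<in> W"
      with W(1) obtain u a where "w = blk u a" "u < 2" by (auto simp: blks_def)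
      with \<open>w \<in> W\<close> False show "w \<in> range (blk (Suc 0))" by (cases "u = 0") (auto simp: less_2_cases_iff)
    qed
    consider "card W = 0" | "card W = 1" | "card W = 2" using W(3) by linarith
    then have "\<exists>v w. v \<in> range (blk (Suc 0)) \<and> w \<in> range (blk (Suc 0)) \<and> W \<subseteq> {v, w}"
    proof cases
      case 1
      with W(2) have "W = {}" by simp
      then show ?thesis by blast
    next
      case 2
      then obtain v where "W = {v}" by (auto simp: card_1_singleton_iff)
      with W1 show ?thesis by (intro exI[of _ v]) simp
    next
      case 3
      then obtain v w where "W = {v, w}" by (auto simp: card_2_iff)
      with W1 show ?thesis by (intro exI[of _ v] exI[of _ w]) simp
    qed
    then obtain a b :: 'a where "W \<subseteq> {blk (Suc 0) a, blk (Suc 0) b}" by blast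
    with W(4) have "x \<in> fv.span {blk (Suc 0) a, blk (Suc 0) b}"
      using fv.span_mono by blast
    then obtain k l where "x - k \<cdot>\<^sub>v blk (Suc 0) a = l \<cdot>\<^sub>v blk (Suc 0) b"
      by (auto simp: fv.span_insert fv.span_singleton)
    then have e: "x i = k * blk (Suc 0) a i + l * blk (Suc 0) b i" for i
      by (auto simp: vscale_def fun_eq_iff algebra_simps)
    have "x 1 = k * (if a = 0 then 0 else 1) + l * (if b = 0 then 0 else 1)"
      "x 2 = k * (if a = 0 then 1 else a) + l * (if b = 0 then 1 else b)"
      "x 3 = k * a\<^sup>2 + l * b\<^sup>2"
      unfolding e by (simp_all add: blk_Suc)
    note x' = this
    show False
    proof (cases "a = 0 \<or> b = 0")
      case True
      then show False using x x' by (cases "a = 0"; cases "b = 0") simp_all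
    next
      case False
      with x x' have l: "l = - k" by (simp add: add_eq_0_iff)
      with False x x' have "k * (a - b) = 0" by (simp add: algebra_simps)
      with x x' l show False by auto
    qed
  qed
qed

section \<open>Uncovered points and the sets M\<close>

text \<open>The first bound of \<open>comb_blks\<close>, applied to every nonzero representative
  \<open>z\<close> because \<open>M_set\<close> asks for all of them; scaling carries coverage of
  \<open>z\<close> back to \<open>x\<close>.\<close>

lemma N_subset_M:
  assumes q: "CARD('a::{field,finite}) = 4 \<or> CARD('a) \<ge> 7"
  shows "(N_set \<rho> :: (nat \<Rightarrow> 'a) set set) \<subseteq> M_set \<rho>"
proof
  fix A :: "(nat \<Rightarrow> 'a) set" assume A: "A \<in> N_set \<rho>"
  then have PG: "A \<in> PG (2*\<rho>+1)" and nc: "\<not> covered \<rho> (S_minus \<rho>) A" by (auto simp: N_set_def)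
  from PG obtain x where x: "A = point x" "x \<in> vecs (2*\<rho>+2)" "x \<noteq> 0"
    by (auto simp: PG_def)
  have "z \<in> M_vecs \<rho>" if z: "z \<in> A" "z \<noteq> 0" for z
  proof (rule ccontr)
    assume "z \<notin> M_vecs \<rho>"
    from z x obtain k where k: "z = k \<cdot>\<^sub>v x" by (auto simp: point_def fv.span_singleton)
    with z have "k \<noteq> 0" by auto
    with k have xz: "x = inverse k \<cdot>\<^sub>v z" by (simp add: vscale_def fun_eq_iff)
    have "z \<in> vecs (2*Suc \<rho>)" using x k by (auto simp: vecs_def vscale_def)
    moreover have "z \<notin> Mv (Suc \<rho>)" using \<open>z \<notin> M_vecs \<rho>\<close> by (simp add: Mv_def)
    ultimately have "comb (blks (Suc \<rho>)) (Suc \<rho>) z" using comb_blks[OF q] by blast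
    then have "comb (blks (Suc \<rho>)) (Suc \<rho>) x"
      unfolding comb_def xz by (blast intro: fv.span_scale)
    with nc show False by (simp add: covered_def S_minus_eq x lin_comb_point)
  qed
  with PG show "A \<in> M_set \<rho>" by (auto simp: M_set_def)
qed

lemma N_set_eq_M_setI:
  assumes q: "CARD('a::{field,finite}) = 4 \<or> CARD('a) \<ge> 7"
    and nc: "\<And>x. x \<in> M_vecs \<rho> \<Longrightarrow> \<not> comb (blks (Suc \<rho>)) (Suc \<rho>) (x :: nat \<Rightarrow> 'a)"
  shows "(N_set \<rho> :: (nat \<Rightarrow> 'a) set set) = M_set \<rho>"
proof
  show "(N_set \<rho> :: (nat \<Rightarrow> 'a) set set) \<subseteq> M_set \<rho>" by (rule N_subset_M[OF q])
  show "M_set \<rho> \<subseteq> (N_set \<rho> :: (nat \<Rightarrow> 'a) set set)"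
  proof
    fix A :: "(nat \<Rightarrow> 'a) set" assume A: "A \<in> M_set \<rho>"
    then have PG: "A \<in> PG (2*\<rho>+1)" and M: "A - {0} \<subseteq> M_vecs \<rho>" by (auto simp: M_set_def)
    from PG obtain x where x: "A = point x" "x \<noteq> 0" by (auto simp: PG_def)
    then have "x \<in> A - {0}" by (auto simp: point_def intro: fv.span_base)
    with M nc have "\<not> comb (blks (Suc \<rho>)) (Suc \<rho>) x" by blast
    with PG x show "A \<in> N_set \<rho>"
      by (simp add: N_set_def covered_def S_minus_eq lin_comb_point)
  qed
qed

lemma N_set_psubset_M_set:
  assumes q: "CARD('a::{field,finite}) = 4 \<or> CARD('a) \<ge> 7"
  shows "(N_set (k+2) :: (nat \<Rightarrow> 'a) set set) \<subset> M_set (k+2)"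
proof -
  let ?r = "Suc (Suc k)"
  \<comment> \<open>With \<rho> = k+2 this is e_{2 rho-2} + e_{2 rho-1} + e_{2 rho+1}. Its
    coordinate \<open>2*k+2\<close> keeps the truncation out of the previous M, yet three vectors
    suffice, and 3 \<le> \<rho>+1.\<close>
  define x :: "nat \<Rightarrow> 'a" where
    "x = (\<lambda>i. if i = 2*k+2 \<or> i = 2*k+3 \<or> i = 2*k+5 then 1 else 0)"
  have x0: "x \<noteq> 0" by (auto simp: x_def fun_eq_iff)
  have "x - 1 \<cdot>\<^sub>v blk (Suc k) 0 - 1 \<cdot>\<^sub>v blk ?r 1 - (-1) \<cdot>\<^sub>v blk ?r 0 = 0"
    by (auto simp: x_def fun_eq_iff vscale_def blk_Suc)
  then have "comb (blks (Suc ?r)) 0 (x - 1 \<cdot>\<^sub>v blk (Suc k) 0 - 1 \<cdot>\<^sub>v blk ?r 1 - (-1) \<cdot>\<^sub>v blk ?r 0)"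
    by (simp only: comb_0)
  from comb_add[OF comb_add[OF comb_add[OF this order_refl] order_refl] order_refl]
  have "comb (blks (Suc ?r)) (Suc (Suc (Suc 0))) x" by (simp add: blk_mem_blks)
  then have "comb (blks (Suc ?r)) (Suc ?r) x" by (rule comb_mono) auto
  then have "point x \<notin> N_set ?r"
    by (simp add: N_set_def covered_def S_minus_eq lin_comb_point)
  moreover have "point x \<in> M_set ?r"
  proof -
    have "x \<in> vecs (2*?r+2)" by (auto simp: x_def vecs_def)
    then have "point x \<in> PG (2*?r+1)" using x0 by (auto simp: PG_def)
    moreover have "c \<cdot>\<^sub>v x \<in> M_vecs ?r" if "c \<noteq> 0" for c
      using that by (simp add: x_def vecs_def vscale_def truncate_def)
    ultimately show ?thesis by (fastforce simp: M_set_def point_def fv.span_singleton)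
  qed
  ultimately show ?thesis using N_subset_M[OF q, of ?r] by auto
qed

section \<open>Saturation and minimality\<close>

lemma point_in_PG: "x \<in> vecs (2*\<rho>+2) \<Longrightarrow> x \<noteq> 0 \<Longrightarrow> point x \<in> PG (2*\<rho>+1)"
  by (auto simp: PG_def)

lemma Svecs_PG: "point ` Svecs \<rho> \<subseteq> PG (2*\<rho>+1)"
proof safe
  fix v :: "nat \<Rightarrow> 'a" assume v: "v \<in> Svecs \<rho>"
  show "point v \<in> PG (2*\<rho>+1)"
  proof (rule point_in_PG)
    show "v \<in> vecs (2*\<rho>+2)"
      using v blk_in_vecs[of _ "Suc \<rho>"] by (auto simp: Svecs_def blks_def) (auto simp: vecs_def unit_vec_def)
    show "v \<noteq> 0"
    proof
      assume "v = 0"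
      with v consider "(0 :: nat \<Rightarrow> 'a) = unit_vec (2*\<rho>+1)" | u a where "0 = blk u (a::'a)"
        by (auto simp: Svecs_def blks_def)
      then show False
      proof cases
        case 1
        from fun_cong[OF 1, of "2*\<rho>+1"] show False by (simp add: unit_vec_def)
      next
        case 2
        from fun_cong[OF 2, of "2*u"] show False using blk_even_nonzero[of u a] by simp
      qed
    qed
  qed
qed

lemma target_nonzero: "v \<le> \<rho> \<Longrightarrow> target \<rho> v a \<noteq> 0"
  using target_even[of v \<rho> 0 a] by auto

text \<open>Used twice: e_{2 rho+1} cannot be dropped from the set, and the set without it is not
  saturating for a value below \<rho>+1.\<close>

lemma not_covered_S_minus:
  "\<exists>A\<in>PG (2*\<rho>+1). \<not> covered \<rho> (S_minus \<rho> :: (nat \<Rightarrow> 'a::field) set set) A"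
proof -
  \<comment> \<open>\<open>x\<close> needs a vector from each lower block, and two from block \<open>\<rho>\<close>.\<close>
  define x :: "nat \<Rightarrow> 'a" where "x = (\<lambda>i. if even i \<and> i < 2*\<rho> \<or> i = 2*\<rho>+1 then 1 else 0)"
  have "\<not> comb (blks (Suc \<rho>)) (Suc \<rho>) x"
    by (rule not_comb_blks) (auto simp: x_def)
  then have "\<not> covered \<rho> (S_minus \<rho>) (point x)"
    by (simp add: covered_def S_minus_eq lin_comb_point)
  moreover have "x (2*\<rho>+1) \<noteq> 0" by (simp add: x_def)
  then have "x \<noteq> 0" by auto
  then have "point x \<in> PG (2*\<rho>+1)" by (intro point_in_PG) (auto simp: x_def vecs_def)
  ultimately show ?thesis by blast
qed

lemma covered_mono: "covered \<rho> S A \<Longrightarrow> S \<subseteq> S' \<Longrightarrow> \<rho> \<le> \<rho>' \<Longrightarrow> covered \<rho>' S' A"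
  unfolding covered_def lin_comb_of_at_most_def by (meson add_le_mono1 order_trans)

lemma saturating_S_minus:
  assumes q: "CARD('a::{field,finite}) = 4 \<or> CARD('a) \<ge> 7"
  shows "saturating (2*\<rho>+1) (\<rho>+1) (S_minus \<rho> :: (nat \<Rightarrow> 'a) set set)"
  unfolding saturating_def
proof (intro conjI ballI allI impI)
  show "S_minus \<rho> \<subseteq> PG (2*\<rho>+1)"
    using Svecs_PG[of \<rho>] by (auto simp: S_minus_eq Svecs_def)
next
  fix A :: "(nat \<Rightarrow> 'a) set" assume "A \<in> PG (2*\<rho>+1)"
  then obtain x where x: "A = point x" "x \<in> vecs (2*Suc \<rho>)" by (auto simp: PG_def)
  then have "comb (blks (Suc \<rho>)) (Suc \<rho> + 1) x" using comb_blks[OF q] by blast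
  then show "covered (\<rho>+1) (S_minus \<rho>) A"
    by (simp add: x covered_def S_minus_eq lin_comb_point)
next
  fix \<rho>' assume "\<rho>' < \<rho> + 1"
  then show "\<not> (\<forall>A\<in>PG (2*\<rho>+1). covered \<rho>' (S_minus \<rho> :: (nat \<Rightarrow> 'a) set set) A)"
    using not_covered_S_minus[of \<rho>, where 'a = 'a] covered_mono[OF _ order_refl, of \<rho>' _ _ \<rho>] by fastforce
qed

lemma saturating_S_set:
  assumes q: "CARD('a::{field,finite}) = 4 \<or> CARD('a) \<ge> 7"
  shows "saturating (2*\<rho>+1) \<rho> (S_set \<rho> :: (nat \<Rightarrow> 'a) set set)"
  unfolding saturating_def
proof (intro conjI ballI allI impI)
  show "S_set \<rho> \<subseteq> PG (2*\<rho>+1)" using Svecs_PG by (simp add: S_set_eq)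
next
  fix A :: "(nat \<Rightarrow> 'a) set" assume "A \<in> PG (2*\<rho>+1)"
  then obtain x where x: "A = point x" "x \<in> vecs (2*\<rho>+2)" by (auto simp: PG_def)
  have sub: "blks (Suc \<rho>) \<subseteq> Svecs \<rho>" "blks \<rho> \<subseteq> Svecs \<rho>"
    using blks_mono[of \<rho> "Suc \<rho>"] by (auto simp: Svecs_def)
  have "comb (Svecs \<rho>) (Suc \<rho>) x"
  proof (cases "x \<in> Mv (Suc \<rho>)")
    case False
    then have "comb (blks (Suc \<rho>)) (Suc \<rho>) x" using comb_blks[OF q, of "Suc \<rho>"] x by auto
    then show ?thesis using sub(1) by (rule comb_mono) simp
  next
    case True
    \<comment> \<open>The recursion of M is made for this: e_{2 rho+1} absorbs the last coordinate,
      and what remains lies outside the previous M, so \<rho> vectors cover it.\<close>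
    then have t: "truncate (2*\<rho>) x \<notin> Mv \<rho>" "x (2*\<rho>) = 0" by (auto simp: mem_Mv_Suc)
    have "x - x (2*\<rho>+1) \<cdot>\<^sub>v unit_vec (2*\<rho>+1) = truncate (2*\<rho>) x"
      by (rule ext4[where n = \<rho>]) (use x t in \<open>auto simp: vscale_def unit_vec_def truncate_def vecs_def\<close>)
    moreover have "comb (blks \<rho>) \<rho> (truncate (2*\<rho>) x)"
      using comb_blks[OF q] t truncate_in_vecs by blast
    ultimately have "comb (blks \<rho>) \<rho> (x - x (2*\<rho>+1) \<cdot>\<^sub>v unit_vec (2*\<rho>+1))" by simp
    then show ?thesis using sub(2) by (rule comb_add) (simp add: Svecs_def)
  qed
  then show "covered \<rho> (S_set \<rho>) A"
    by (simp add: x covered_def S_set_eq lin_comb_point)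
next
  fix \<rho>' assume r: "\<rho>' < \<rho>"
  \<comment> \<open>All its even coordinates are nonzero, so each of the \<rho>+1 blocks must
    contribute.\<close>
  let ?x = "target \<rho> \<rho> 0 :: nat \<Rightarrow> 'a"
  have "\<not> comb (Svecs \<rho>) (\<rho>' + 1) ?x"
  proof
    assume "comb (Svecs \<rho>) (\<rho>' + 1) ?x"
    then obtain W where W: "W \<subseteq> Svecs \<rho>" "finite W" "card W \<le> \<rho>' + 1" "?x \<in> fv.span W"
      by (auto simp: comb_def)
    have "\<exists>a. blk u a \<in> W" if "u \<le> \<rho>" for u
      using block_used[OF W(1,4) target_even[OF order_refl that]] .
    from one_per_block(1)[OF W(2), of \<rho>, OF this] W(3) r show False by simp
  qed
  then have "\<not> covered \<rho>' (S_set \<rho>) (point ?x)"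
    by (simp add: covered_def S_set_eq lin_comb_point)
  moreover have "point ?x \<in> PG (2*\<rho>+1)"
    by (intro point_in_PG target_in_vecs target_nonzero) auto
  ultimately show "\<not> (\<forall>A\<in>PG (2*\<rho>+1). covered \<rho>' (S_set \<rho> :: (nat \<Rightarrow> 'a) set set) A)" by blast
qed

text \<open>A proper subset misses the point of some \<open>p\<close>. If
  \<open>p = blk v a\<close>, then \<open>target \<rho> v a\<close> is not covered; if
  \<open>p\<close> is e_{2 rho+1}, the subset lies in \<open>S_minus \<rho>\<close>.\<close>

lemma minimal_saturating_S_set:
  assumes q: "CARD('a::{field,finite}) = 4 \<or> CARD('a) \<ge> 7"
  shows "minimal_saturating (2*\<rho>+1) \<rho> (S_set \<rho> :: (nat \<Rightarrow> 'a) set set)"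
  unfolding minimal_saturating_def
proof (intro conjI notI)
  show "saturating (2*\<rho>+1) \<rho> (S_set \<rho> :: (nat \<Rightarrow> 'a) set set)" by (rule saturating_S_set[OF q])
next
  assume "\<exists>T\<subset>S_set \<rho> :: (nat \<Rightarrow> 'a) set set. saturating (2*\<rho>+1) \<rho> T"
  then obtain T :: "(nat \<Rightarrow> 'a) set set" where T: "T \<subset> S_set \<rho>"
    and cov: "\<And>A. A \<in> PG (2*\<rho>+1) \<Longrightarrow> covered \<rho> T A" by (auto simp: saturating_def)
  from T obtain p where p: "p \<in> Svecs \<rho>" "point p \<notin> T" by (auto simp: S_set_eq)
  have sub: "T \<subseteq> point ` (Svecs \<rho> - {p})" using T p by (auto simp: S_set_eq)
  have comb: "comb (Svecs \<rho> - {p}) (Suc \<rho>) x" if "x \<in> vecs (2*\<rho>+2)" "x \<noteq> 0" for x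
    using covered_mono[OF cov[OF point_in_PG[OF that]] sub order_refl]
    by (simp add: covered_def lin_comb_point)
  show False
  proof (cases "p = unit_vec (2*\<rho>+1)")
    case True
    then have "T \<subseteq> S_minus \<rho>" using T p by (auto simp: S_minus_def)
    then show False using not_covered_S_minus[of \<rho>, where 'a = 'a] covered_mono[OF cov _ order_refl] by blast
  next
    case False
    with p obtain v a where v: "p = blk v a" "v \<le> \<rho>" by (auto simp: Svecs_def blks_def)
    from comb[OF target_in_vecs target_nonzero, OF v(2) v(2)]
    obtain W where "W \<subseteq> Svecs \<rho> - {p}" "finite W" "card W \<le> Suc \<rho>" "target \<rho> v a \<in> fv.span W"
      by (auto simp: comb_def)
    with target_essential[of W \<rho> v a] v show False by blast
  qed
qed

theorem theorem3p1:
  fixes q \<rho> :: nat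
  assumes "CARD('a::{field,finite}) = q"
    and "q = 4 \<or> q \<ge> 7"
  shows "(card (S_set \<rho> :: (nat \<Rightarrow> 'a) set set) = (\<rho> + 1) * q + 1 \<and>
          minimal_saturating (2*\<rho> + 1) \<rho> (S_set \<rho> :: (nat \<Rightarrow> 'a) set set)) \<and>
         ((N_set 0 :: (nat \<Rightarrow> 'a) set set) = M_set 0 \<and>
          (N_set 1 :: (nat \<Rightarrow> 'a) set set) = M_set 1 \<and>
          (\<rho> \<ge> 2 \<longrightarrow> (N_set \<rho> :: (nat \<Rightarrow> 'a) set set) \<subset> M_set \<rho>)) \<and>
         (card (S_minus \<rho> :: (nat \<Rightarrow> 'a) set set) = (\<rho> + 1) * q \<and>
          saturating (2*\<rho> + 1) (\<rho> + 1) (S_minus \<rho> :: (nat \<Rightarrow> 'a) set set))"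
proof -
  have q: "CARD('a) = 4 \<or> CARD('a) \<ge> 7" using assms by simp
  have S: "card (S_set \<rho> :: (nat \<Rightarrow> 'a) set set) = (\<rho> + 1) * q + 1"
    using assms(1) unit_notin_blks[of \<rho> "Suc \<rho>", where 'a = 'a]
    unfolding S_set_eq card_image[OF inj_on_point_Svecs] by (simp add: Svecs_def finite_blks card_blks)
  have "inj_on point (blks (Suc \<rho>) :: (nat \<Rightarrow> 'a) set)"
    by (rule inj_on_subset[OF inj_on_point_Svecs[of \<rho>]]) (auto simp: Svecs_def)
  then have Sm: "card (S_minus \<rho> :: (nat \<Rightarrow> 'a) set set) = (\<rho> + 1) * q"
    using assms(1) by (simp add: S_minus_eq card_image card_blks)
  have N0: "(N_set 0 :: (nat \<Rightarrow> 'a) set set) = M_set 0"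
    by (rule N_set_eq_M_setI[OF q], rule not_comb_blks) auto
  have N1: "(N_set 1 :: (nat \<Rightarrow> 'a) set set) = M_set 1"
  proof (rule N_set_eq_M_setI[OF q])
    fix x :: "nat \<Rightarrow> 'a" assume "x \<in> M_vecs 1"
    then have x: "truncate 2 x \<notin> M_vecs 0" "x 2 = 0" "x 3 \<noteq> 0"
      by (auto simp: numeral_3_eq_3 numeral_2_eq_2)
    \<comment> \<open>For \<open>x 0 = 0\<close> the condition on the truncation leaves (0, 0, 0,
      t); otherwise \<open>x 0\<close> forces a vector of block 0.\<close>
    show "\<not> comb (blks (Suc 1)) (Suc 1) x"
    proof (cases "x 0 = 0")
      case True
      with x truncate_in_vecs[of 2 x] have "x 1 = 0" by (auto simp: truncate_def split: if_splits)
      with True x not_comb_blks_2[of x] show ?thesis by (simp add: numeral_2_eq_2)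
    next
      case False
      with x show ?thesis by (intro not_comb_blks) (auto simp: numeral_3_eq_3)
    qed
  qed
  have "\<rho> \<ge> 2 \<longrightarrow> (N_set \<rho> :: (nat \<Rightarrow> 'a) set set) \<subset> M_set \<rho>"
  proof
    assume "\<rho> \<ge> 2"
    then have "\<rho> - 2 + 2 = \<rho>" by simp
    then show "N_set \<rho> \<subset> (M_set \<rho> :: (nat \<Rightarrow> 'a) set set)"
      using N_set_psubset_M_set[OF q, of "\<rho> - 2"] by metis
  qed
  with S Sm N0 N1 minimal_saturating_S_set[OF q] saturating_S_minus[OF q] show ?thesis by blast
qed

end
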